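(* Let $q$ be an odd prime power and $n$ an odd prime with $(q^n-1)/2$ even, and let $Q=\frac{q^n-1}{q-1}$. Write the product of the distinct primes dividing $Q$ as $k p_1\cdots p_s$ with $p_1,\dots,p_s$ distinct primes (not dividing $k$), and set $\delta=1-\sum_{i=1}^s\frac1{p_i}$. Assume $\delta>0$. Then $$\mathcal{N}_0(Q)>\delta\,\theta(k)\,q^{\frac n2}\left\{q^{\frac n2-1}-2\left(\frac{s-1}{\delta}+2\right)W(k)\right\}.$$ Hence, if $q^{\frac n2-1}>2\left(\frac{s-1}{\delta}+2\right)W(k)$, then $\mathcal{N}_0(q^n-1)>0$.
   Context: For a divisor $m$ of $q^n-1$, $\xi\in\mathbb{F}_{q^n}^*$ is $m$-free if $\xi=\zeta^d$ with $d\mid m$, $\zeta\in\mathbb{F}_{q^n}^*$ implies $d=1$. $\mathcal{N}_0(m)$ is the number of $m$-free $\xi\in\mathbb{F}_{q^n}^*$ with $\mathrm{Tr}(\xi^2)=0$, where $\mathrm{Tr}:\mathbb{F}_{q^n}\to\mathbb{F}_q$ is the trace; $\mathcal{N}_0(m)$ depends only on the set of primes dividing $m$. $\theta(m)=\phi(m)/m$, and $W(m)=2^{\nu(m)}$ with $\nu(m)$ the number of distinct prime divisors of $m$. *)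

theory Defs
  imports Complex_Main "HOL-Library.Cardinality" "HOL-Number_Theory.Number_Theory"
begin

text \<open>
  The field with \<open>q ^ n\<close> elements is a type \<open>'a :: finite_field\<close> with \<open>CARD('a) = q ^ n\<close>; its
  subfield with \<open>q\<close> elements is \<open>{x. x ^ q = x}\<close>. The trace onto this subfield is the sum of the
  conjugates under the Frobenius map \<open>x \<mapsto> x ^ q\<close>.
\<close>

definition ff_trace :: "nat \<Rightarrow> nat \<Rightarrow> 'a::finite_field \<Rightarrow> 'a" where
  "ff_trace q n x = (\<Sum>i<n. x ^ (q ^ i))"

definition m_free :: "nat \<Rightarrow> 'a::finite_field \<Rightarrow> bool" where
  "m_free m \<xi> \<longleftrightarrow> \<xi> \<noteq> 0 \<and> (\<forall>d \<zeta>. d dvd m \<and> \<zeta> \<noteq> 0 \<and> \<xi> = \<zeta> ^ d \<longrightarrow> d = 1)"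

definition N0 :: "'a::finite_field itself \<Rightarrow> nat \<Rightarrow> nat \<Rightarrow> nat \<Rightarrow> nat" where
  "N0 _ q n m = card {\<xi>::'a. m_free m \<xi> \<and> ff_trace q n (\<xi>\<^sup>2) = 0}"

definition \<theta> :: "nat \<Rightarrow> real" where
  "\<theta> m = real (totient m) / real m"

definition W :: "nat \<Rightarrow> nat" where
  "W m = 2 ^ card (prime_factors m)"

lemma finite_field_pow_card:
  fixes x :: "'a::finite_field"
  shows "x ^ CARD('a) = x"
proof (cases "x = 0")
  case False
  let ?U = "UNIV - {0 :: 'a}"
  have "bij_betw ((*) x) ?U ?U"
    by (rule bij_betwI[where g = "\<lambda>y. y / x"]) (use False in auto)
  then have "(\<Prod>y\<in>?U. x * y) = \<Prod>?U"
    by (rule prod.reindex_bij_betw)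
  moreover have "(\<Prod>y\<in>?U. x * y) = x ^ card ?U * \<Prod>?U"
    by (simp add: prod.distrib)
  ultimately have "x ^ card ?U = 1"
    by simp
  moreover have "CARD('a) = Suc (card ?U)"
    by (rule card.remove) simp_all
  ultimately show ?thesis by (simp only: power_Suc mult_1_right)
qed (simp add: zero_power)

lemma ff_trace_in_subfield:
  fixes x :: "'a::finite_field"
  assumes "CARD('a) = q ^ n" "primepow q" "n > 0"
  shows "ff_trace q n x ^ q = ff_trace q n x"
proof -
  from assms(2) obtain p e where p: "prime p" "q = p ^ e"
    by (auto simp: primepow_def)
  have "CHAR('a) dvd p ^ (e * n)"
    using CHAR_dvd_CARD[where 'a = 'a] by (simp only: assms(1) p(2) power_mult)
  moreover have "prime CHAR('a)"
    by (simp add: prime_CHAR_semidom)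
  ultimately have "CHAR('a) = p"
    using p(1) prime_dvd_power primes_dvd_imp_eq by blast
  then have q: "q = CHAR('a) ^ e"
    using p(2) by simp
  have "ff_trace q n x ^ q = (\<Sum>i<n. (x ^ q ^ i) ^ q)"
    unfolding ff_trace_def by (rule freshmans_dream_sum'[OF \<open>prime CHAR('a)\<close> q])
  also have "\<dots> = (\<Sum>i<n. x ^ q ^ Suc i)"
    by (simp only: power_mult[symmetric] power_Suc2)
  finally have "ff_trace q n x ^ q + x = (\<Sum>i<n. x ^ q ^ Suc i) + x ^ q ^ 0"
    by simp
  also have "\<dots> = (\<Sum>i<Suc n. x ^ q ^ i)"
    by (simp only: sum.lessThan_Suc_shift add.commute)
  also have "\<dots> = ff_trace q n x + x"
    using finite_field_pow_card[of x] by (simp only: ff_trace_def sum.lessThan_Suc assms(1))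
  finally show ?thesis by simp
qed

end

theory Submission
  imports Defs "HOL-Computational_Algebra.Polynomial"
begin

text \<open>
  Let \<open>g\<close> generate the multiplicative group. The exponents \<open>a\<close> modulo \<open>Q\<close> with \<open>Tr (g ^ a) = 0\<close> form
  the Singer difference set, and since \<open>Q\<close> is odd so do those with \<open>Tr (g ^ (2 * a)) = 0\<close>. The
  constant autocorrelation off the diagonal shows that all nontrivial exponential sums over such a
  set have absolute value \<open>q powr (n / 2 - 1)\<close>, so no additive characters or Gauss sums are needed.
  An exponent gives a \<open>Q\<close>-free element iff it is prime to \<open>Q\<close>; expanding this condition into
  \<open>Q\<close>-th roots of unity and applying the sieve over \<open>p\<^sub>1, \<dots>, p\<^sub>s\<close> gives the bound. Finally, a
  \<open>Q\<close>-free element becomes primitive after multiplication by a suitable element of the subfield,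
  which scales the trace of the square by a nonzero factor.
\<close>

subsection \<open>Exponential sums of periodic functions\<close>

lemma root_of_unity_coprime_eq_1:
  fixes u :: "'a::idom"
  assumes "u ^ a = 1" "u ^ b = 1" "coprime a b"
  shows "u = 1"
proof (cases "a = 0")
  case True
  then show ?thesis using assms by simp
next
  case False
  from bezout_nat[OF this] obtain x y where "a * x = b * y + gcd a b" by blast
  with assms(3) have "a * x = b * y + 1" by (simp only: coprime_iff_gcd_eq_1)
  then have "u ^ (a * x) = u ^ (b * y) * u" by (simp only: power_add power_one_right)
  then have "(u ^ a) ^ x = (u ^ b) ^ y * u" by (simp only: power_mult)
  with assms(1,2) show ?thesis by simp
qed

text \<open>Multiplication by a unit followed by a translation permutes the residues modulo
  \<open>N\<close>. Two cases are used: translations, and doubling for odd \<open>N\<close>, which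
  exchanges the conditions on \<open>g ^ a\<close> and on its square.\<close>

lemma sum_periodic_affine:
  fixes h :: "nat \<Rightarrow> 'b::comm_monoid_add" and N u v :: nat
  assumes "N > 0" and per: "\<And>a. h (a + N) = h a" and cop: "coprime u N"
  shows "(\<Sum>c<N. h (u * c + v)) = (\<Sum>c<N. h c)"
proof -
  have mult: "h (a + N * j) = h a" for a j
  proof (induction j)
    case (Suc j)
    then show ?case using per[of "a + N * j"] by (simp add: algebra_simps)
  qed simp
  have hmod: "h a = h (a mod N)" for a
    using mult[of "a mod N" "a div N"] by simp
  have inj: "inj_on (\<lambda>c. (u * c + v) mod N) {..<N}"
  proof (rule inj_onI)
    fix x y assume xy: "x \<in> {..<N}" "y \<in> {..<N}" and "(u * x + v) mod N = (u * y + v) mod N"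
    then have "[u * x = u * y] (mod N)" by (simp add: cong_def[symmetric] cong_add_rcancel_nat)
    then have "[x = y] (mod N)" using cop by (simp add: cong_mult_lcancel_nat)
    with xy show "x = y" by (simp add: cong_def)
  qed
  have "(\<lambda>c. (u * c + v) mod N) ` {..<N} \<subseteq> {..<N}" using \<open>N > 0\<close> by auto
  then have "bij_betw (\<lambda>c. (u * c + v) mod N) {..<N} {..<N}"
    using inj by (simp add: bij_betw_def endo_inj_surj)
  from sum.reindex_bij_betw[OF this, of h] show ?thesis by (simp flip: hmod)
qed

lemma sum_periodic_shift:
  fixes h :: "nat \<Rightarrow> 'b::comm_monoid_add" and N v :: nat
  assumes "N > 0" "\<And>a. h (a + N) = h a"
  shows "(\<Sum>c<N. h (v + c)) = (\<Sum>c<N. h c)"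
  using sum_periodic_affine[of N h 1 v] assms by (simp add: add.commute)

lemma sum_periodic_multiple:
  fixes h :: "nat \<Rightarrow> real"
  assumes "\<And>a. h (a + N) = h a"
  shows "(\<Sum>a<N * m. h a) = real m * (\<Sum>a<N. h a)"
proof -
  have mult: "h (a + j * N) = h a" for a j
  proof (induction j)
    case (Suc j)
    then show ?case using assms[of "a + j * N"] by (simp add: algebra_simps)
  qed simp
  have "(\<Sum>a<N * m. h a) = (\<Sum>j<m. sum h {j * N..<j * N + N})"
    by (simp only: sum.nat_group mult.commute)
  also have "\<dots> = (\<Sum>j<m. \<Sum>a<N. h a)"
  proof (rule sum.cong[OF refl])
    fix j
    have "sum h {j * N..<j * N + N} = (\<Sum>a=0..<N. h (a + j * N))"
      using sum.shift_bounds_nat_ivl[of h 0 "j * N" N] by (simp add: add.commute)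
    then show "sum h {j * N..<j * N + N} = (\<Sum>a<N. h a)"
      by (simp only: mult atLeast0LessThan)
  qed
  finally show ?thesis by simp
qed

lemma sum_periodic_double:
  fixes h :: "nat \<Rightarrow> 'b::comm_monoid_add" and N :: nat
  assumes "odd N" "\<And>a. h (a + N) = h a"
  shows "(\<Sum>c<N. h (2 * c)) = (\<Sum>c<N. h c)"
  using sum_periodic_affine[of N h 2 0] assms odd_pos[OF assms(1)] by simp

text \<open>The squared modulus of an exponential sum is the exponential sum of the autocorrelation.
  Its constant part \<mu> contributes nothing because the powers of \<open>w\<close> over a full
  period cancel, so only the excess \<kappa> - \<mu> at shift 0 survives.\<close>

lemma norm_exp_sum_of_autocorrelation:
  fixes f :: "nat \<Rightarrow> real" and w :: complex and \<kappa> \<mu> :: real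
  assumes "N > 0" and per: "\<And>a. f (a + N) = f a"
    and w: "w ^ N = 1" "w \<noteq> 1"
    and diag: "(\<Sum>a<N. f a * f a) = \<kappa>"
    and off: "\<And>b. 0 < b \<Longrightarrow> b < N \<Longrightarrow> (\<Sum>a<N. f a * f (a + b)) = \<mu>"
  shows "(norm (\<Sum>a<N. of_real (f a) * w ^ a))\<^sup>2 = \<kappa> - \<mu>"
proof -
  let ?S = "\<Sum>a<N. of_real (f a) * w ^ a"
  have "norm w ^ N = 1" using w(1) by (metis norm_one norm_power)
  then have "norm w = 1" using \<open>N > 0\<close> power_eq_imp_eq_base[of "norm w" N 1] by simp
  then have unit: "w ^ a * cnj (w ^ a) = 1" for a
    using complex_norm_square[of "w ^ a"] by (simp add: norm_power)
  have "complex_of_real ((norm ?S)\<^sup>2) = cnj ?S * ?S"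
    using complex_norm_square[of ?S] by (simp only: mult.commute)
  also have "\<dots> = (\<Sum>a<N. of_real (f a) * cnj (w ^ a) * ?S)"
    by (simp add: sum_distrib_right)
  also have "\<dots> = (\<Sum>a<N. \<Sum>b<N. of_real (f a * f (a + b)) * w ^ b)"
  proof (rule sum.cong[OF refl])
    fix a
    have "?S = (\<Sum>b<N. of_real (f (a + b)) * w ^ (a + b))"
      by (rule sum_periodic_shift[symmetric]) (simp_all add: \<open>N > 0\<close> per power_add w)
    then have "of_real (f a) * cnj (w ^ a) * ?S
        = (\<Sum>b<N. of_real (f a) * cnj (w ^ a) * (of_real (f (a + b)) * w ^ (a + b)))"
      by (simp only: sum_distrib_left)
    also have "\<dots> = (\<Sum>b<N. of_real (f a * f (a + b)) * w ^ b * (w ^ a * cnj (w ^ a)))"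
      by (simp add: power_add mult_ac)
    finally show "of_real (f a) * cnj (w ^ a) * ?S = (\<Sum>b<N. of_real (f a * f (a + b)) * w ^ b)"
      by (simp only: unit mult_1_right)
  qed
  also have "\<dots> = (\<Sum>b<N. of_real (\<Sum>a<N. f a * f (a + b)) * w ^ b)"
    by (subst sum.swap) (simp add: sum_distrib_right)
  also have "\<dots> = (\<Sum>b<N. of_real \<mu> * w ^ b + (if b = 0 then of_real (\<kappa> - \<mu>) else 0))"
  proof (rule sum.cong[OF refl])
    fix b assume "b \<in> {..<N}"
    then show "of_real (\<Sum>a<N. f a * f (a + b)) * w ^ b
        = of_real \<mu> * w ^ b + (if b = 0 then of_real (\<kappa> - \<mu>) else 0)"
    proof (cases "b = 0")
      case True
      then show ?thesis using diag by simp
    next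
      case False
      then show ?thesis using off[of b] \<open>b \<in> {..<N}\<close> by (simp only: lessThan_iff neq0_conv) simp
    qed
  qed
  also have "\<dots> = of_real \<mu> * (\<Sum>b<N. w ^ b) + of_real (\<kappa> - \<mu>)"
    using \<open>N > 0\<close> by (simp add: sum.distrib sum_distrib_left)
  also have "(\<Sum>b<N. w ^ b) = 0"
    using w by (simp add: geometric_sum)
  finally show ?thesis by (simp only: mult_zero_right add_0 of_real_eq_iff)
qed

text \<open>The Ramanujan sum of prime modulus. If \<open>p\<close> does not divide
  \<open>a\<close>, taking \<open>a\<close>-th powers permutes the \<open>p\<close>-th roots of
  unity, whose total is 0; otherwise all \<open>p\<close> terms are 1. Removing the root 1 accounts
  for the \<open>- 1\<close>.\<close>

lemma sum_nontrivial_roots_unity_power: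
  fixes p a :: nat
  assumes "prime p"
  shows "(\<Sum>z | z ^ p = 1 \<and> z \<noteq> (1::complex). z ^ a) = of_real (real p * of_bool (p dvd a) - 1)"
proof -
  have p: "p > 1" "p > 0" using assms by (rule prime_gt_1_nat, rule prime_gt_0_nat)
  let ?U = "{z::complex. z ^ p = 1}"
  have fin: "finite ?U" using p by (simp add: finite_roots_unity)
  have "(\<Sum>z\<in>?U. z ^ a) = of_real (real p * of_bool (p dvd a))"
  proof (cases "p dvd a")
    case True
    then have "z ^ a = 1" if "z \<in> ?U" for z
      using that by (metis (mono_tags) dvdE mem_Collect_eq power_mult power_one)
    then show ?thesis using True p by (simp add: card_roots_unity_eq)
  next
    case False
    then have cop: "coprime a p" using assms by (metis prime_imp_coprime coprime_commute)
    have "inj_on (\<lambda>z. z ^ a) ?U"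
    proof (rule inj_onI)
      fix y z assume yz: "y \<in> ?U" "z \<in> ?U" "y ^ a = z ^ a"
      then have "z \<noteq> 0" using p by (auto simp: zero_power)
      then have "(y / z) ^ a = 1" "(y / z) ^ p = 1" using yz by (simp_all add: power_divide)
      then have "y / z = 1" using cop by (rule root_of_unity_coprime_eq_1)
      then show "y = z" using \<open>z \<noteq> 0\<close> by simp
    qed
    moreover have "(\<lambda>z. z ^ a) ` ?U \<subseteq> ?U" by clarsimp (metis power_commuting_commutes power_mult mult.commute power_one)
    ultimately have "bij_betw (\<lambda>z. z ^ a) ?U ?U"
      using fin by (simp add: bij_betw_def endo_inj_surj)
    from sum.reindex_bij_betw[OF this, of "\<lambda>z. z"] show ?thesis
      using False sum_roots_unity[OF p(1)] by simp
  qed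
  moreover have "{z. z ^ p = 1 \<and> z \<noteq> (1::complex)} = ?U - {1}" by auto
  ultimately show ?thesis using fin by (simp add: sum_diff1)
qed

lemma card_nontrivial_roots_unity:
  fixes p :: nat
  assumes "p > 0"
  shows "card {z. z ^ p = 1 \<and> z \<noteq> (1::complex)} = p - 1"
proof -
  have "{z. z ^ p = 1 \<and> z \<noteq> (1::complex)} = {z. z ^ p = 1} - {1}" by auto
  then show ?thesis using assms by (simp add: card_roots_unity_eq card_Diff_singleton finite_roots_unity)
qed

subsection \<open>The sieve\<close>

definition sifted_sum :: "(nat \<Rightarrow> real) \<Rightarrow> nat \<Rightarrow> nat set \<Rightarrow> real" where
  "sifted_sum f N S = (\<Sum>a<N. f a * of_bool (\<forall>p\<in>S. \<not> p dvd a))"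

definition euler_ratio :: "nat set \<Rightarrow> real" where
  "euler_ratio S = (\<Prod>p\<in>S. 1 - 1 / real p)"

text \<open>
  The numerator is minus the Ramanujan sum \<open>c\<^sub>p(a)\<close>, the sum of \<open>z ^ a\<close> over the \<open>p\<close>-th roots of
  unity \<open>z \<noteq> 1\<close>; the weight is chosen so that \<open>(1 - 1 / p) * (1 + ramanujan_weight p a)\<close> is the
  indicator of \<open>\<not> p dvd a\<close>.
\<close>

definition ramanujan_weight :: "nat \<Rightarrow> nat \<Rightarrow> real" where
  "ramanujan_weight p a = - (real p * of_bool (p dvd a) - 1) / (real p - 1)"

lemma euler_ratio_pos:
  assumes "\<And>p. p \<in> S \<Longrightarrow> prime p"
  shows "euler_ratio S > 0"
  unfolding euler_ratio_def
proof (rule prod_pos)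
  fix p assume "p \<in> S"
  then have "p > 1" using assms prime_gt_1_nat by blast
  then show "1 - 1 / real p > 0" by simp
qed

text \<open>The inequality holds termwise. If some \<open>r\<close> in \<open>P\<close> divides
  \<open>a\<close>, at most \<open>card P - 1\<close> of the single-prime indicators are 1, so the
  contribution on the right is at most 0; if none does, it is exactly 1. The subtraction is done in
  the reals, so an empty \<open>P\<close> gives equality.\<close>

lemma sifted_sum_ge:
  assumes "finite P" "\<And>a. f a \<ge> 0"
  shows "sifted_sum f N (S \<union> P)
    \<ge> (\<Sum>p\<in>P. sifted_sum f N (insert p S)) - (real (card P) - 1) * sifted_sum f N S"
proof -
  have pointwise: "(\<Sum>p\<in>P. of_bool (\<not> p dvd a)) - (real (card P) - 1)
      \<le> of_bool (\<forall>p\<in>P. \<not> p dvd a)" for a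
    using assms(1)
  proof (cases "\<forall>p\<in>P. \<not> p dvd a")
    case False
    then obtain r where r: "r \<in> P" "r dvd a" by blast
    have "(\<Sum>p\<in>P. of_bool (\<not> p dvd a)) = (\<Sum>p\<in>P - {r}. of_bool (\<not> p dvd a) :: real)"
      using r assms(1) by (subst sum.remove[of _ r]) auto
    also have "\<dots> \<le> (\<Sum>p\<in>P - {r}. 1)" by (rule sum_mono) simp
    also have "\<dots> = real (card P) - 1"
      using r assms(1) by (simp add: card_Diff_singleton card_gt_0_iff of_nat_diff Suc_leI)
        (metis Suc_leI card_gt_0_iff emptyE of_nat_1 of_nat_diff One_nat_def)
    finally show ?thesis by simp
  qed simp
  have "(\<Sum>p\<in>P. sifted_sum f N (insert p S)) - (real (card P) - 1) * sifted_sum f N S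
      = (\<Sum>a<N. f a * of_bool (\<forall>p\<in>S. \<not> p dvd a)
          * ((\<Sum>p\<in>P. of_bool (\<not> p dvd a)) - (real (card P) - 1)))"
  proof -
    let ?s = "\<lambda>a. f a * of_bool (\<forall>p\<in>S. \<not> p dvd a)"
    have "(\<Sum>p\<in>P. sifted_sum f N (insert p S)) = (\<Sum>a<N. ?s a * (\<Sum>p\<in>P. of_bool (\<not> p dvd a)))"
      unfolding sifted_sum_def sum_distrib_left
      by (subst sum.swap) (intro sum.cong refl, auto)
    moreover have "(real (card P) - 1) * sifted_sum f N S = (\<Sum>a<N. ?s a * (real (card P) - 1))"
      by (simp only: sifted_sum_def sum_distrib_left mult.commute)
    ultimately show ?thesis
      by (simp only: sum_subtractf[symmetric] right_diff_distrib[symmetric])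
  qed
  also have "\<dots> \<le> (\<Sum>a<N. f a * of_bool (\<forall>p\<in>S. \<not> p dvd a) * of_bool (\<forall>p\<in>P. \<not> p dvd a))"
    by (intro sum_mono mult_left_mono pointwise) (simp add: assms)
  also have "\<dots> = sifted_sum f N (S \<union> P)"
    unfolding sifted_sum_def by (intro sum.cong refl) auto
  finally show ?thesis .
qed

section \<open>Sieving from a uniform bound \<open>R\<close> on the nontrivial exponential sums of
  \<open>f\<close>\<close>

context
  fixes f :: "nat \<Rightarrow> real" and N :: nat and R :: real
  assumes exp_sum_le: "\<And>w::complex. w ^ N = 1 \<Longrightarrow> w \<noteq> 1 \<Longrightarrow> norm (\<Sum>a<N. of_real (f a) * w ^ a) \<le> R"
begin

text \<open>Writing the factor at \<open>r\<close> as a sum over the \<open>r - 1\<close> nontrivial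
  \<open>r\<close>-th roots of unity \<open>z\<close> replaces the twist \<open>w\<close> by
  \<open>w * z\<close> and removes \<open>r\<close> from \<open>T\<close>. The twist
  \<open>w\<close> and the exponent \<open>m\<close> generalise the statement for this induction:
  \<open>m\<close> kills the twist collected so far and is prime to the primes still in
  \<open>T\<close>, which keeps the final twist away from 1.\<close>

lemma norm_twisted_ramanujan_sum_le:
  fixes w :: complex and m :: nat
  assumes "finite T" "\<And>p. p \<in> T \<Longrightarrow> prime p \<and> p dvd N \<and> \<not> p dvd m"
    and "w ^ N = 1" "w ^ m = 1" "T \<noteq> {} \<or> w \<noteq> 1"
  shows "norm (\<Sum>a<N. of_real (f a * (\<Prod>p\<in>T. real p * of_bool (p dvd a) - 1)) * w ^ a)
    \<le> (\<Prod>p\<in>T. real p - 1) * R"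
  using assms
proof (induction T arbitrary: w m rule: finite_induct)
  case empty
  then show ?case using exp_sum_le[of w] by simp
next
  case (insert r T)
  let ?Z = "{z. z ^ r = 1 \<and> z \<noteq> (1::complex)}"
  let ?c = "\<lambda>a. \<Prod>p\<in>T. real p * of_bool (p dvd a) - 1"
  have r: "prime r" "r dvd N" "\<not> r dvd m" using insert.prems(1) by auto
  have step: "norm (\<Sum>a<N. of_real (f a * ?c a) * (w * z) ^ a) \<le> (\<Prod>p\<in>T. real p - 1) * R"
    if z: "z \<in> ?Z" for z
  proof (rule insert.IH[where m = "m * r"])
    show "prime p \<and> p dvd N \<and> \<not> p dvd m * r" if "p \<in> T" for p
    proof -
      have "prime p \<and> p dvd N \<and> \<not> p dvd m" "p \<noteq> r" using insert.prems(1) insert.hyps that by auto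
      then show ?thesis using r(1) primes_dvd_imp_eq prime_dvd_mult_iff by blast
    qed
    obtain t where "N = r * t" using r(2) by blast
    then have "z ^ N = 1" using z by (simp add: power_mult)
    then show "(w * z) ^ N = 1" using insert.prems(2) by (simp add: power_mult_distrib)
    have "w ^ (m * r) = 1" "z ^ (m * r) = 1"
      using insert.prems(3) z by (simp add: power_mult, simp add: mult.commute[of m] power_mult)
    then show "(w * z) ^ (m * r) = 1" by (simp add: power_mult_distrib)
    \<comment> \<open>Otherwise \<open>w\<close>, being inverse to \<open>z\<close>, is killed by
      both \<open>r\<close> and \<open>m\<close>. These are coprime, so \<open>w = 1\<close> and
      then \<open>z = 1\<close>.\<close>
    have "w * z \<noteq> 1"
    proof
      assume wz: "w * z = 1"
      have "w ^ r = (w * z) ^ r" using z by (simp add: power_mult_distrib)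
      then have "w ^ r = 1" using wz by simp
      moreover have "coprime m r" using r by (metis prime_imp_coprime coprime_commute)
      ultimately have "w = 1" using insert.prems(3) root_of_unity_coprime_eq_1 by blast
      then show False using wz z by simp
    qed
    then show "T \<noteq> {} \<or> w * z \<noteq> 1" by blast
  qed
  have "(\<Sum>a<N. of_real (f a * (\<Prod>p\<in>insert r T. real p * of_bool (p dvd a) - 1)) * w ^ a)
      = (\<Sum>a<N. of_real (f a * ?c a) * w ^ a * of_real (real r * of_bool (r dvd a) - 1))"
    using insert.hyps by (simp add: mult_ac)
  also have "\<dots> = (\<Sum>a<N. of_real (f a * ?c a) * w ^ a * (\<Sum>z\<in>?Z. z ^ a))"
    by (simp only: sum_nontrivial_roots_unity_power[OF r(1)])
  also have "\<dots> = (\<Sum>a<N. \<Sum>z\<in>?Z. of_real (f a * ?c a) * (w * z) ^ a)"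
    by (simp only: sum_distrib_left power_mult_distrib mult.assoc)
  also have "\<dots> = (\<Sum>z\<in>?Z. \<Sum>a<N. of_real (f a * ?c a) * (w * z) ^ a)"
    by (rule sum.swap)
  also have "norm \<dots> \<le> (\<Sum>z\<in>?Z. (\<Prod>p\<in>T. real p - 1) * R)"
    by (intro sum_norm_le step)
  also have "\<dots> = real (r - 1) * ((\<Prod>p\<in>T. real p - 1) * R)"
    using prime_gt_0_nat[OF r(1)] by (simp only: sum_constant card_nontrivial_roots_unity)
  also have "\<dots> = (\<Prod>p\<in>insert r T. real p - 1) * R"
    using insert.hyps prime_gt_0_nat[OF r(1)] by (simp add: of_nat_diff Suc_leI)
  finally show ?case .
qed

text \<open>The untwisted case \<open>w = 1\<close>, \<open>m = 1\<close>. The number of choices of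
  nontrivial roots, the product of the \<open>p - 1\<close>, cancels exactly against the
  denominators of the weights, so the bound does not depend on a nonempty \<open>T\<close>.\<close>

lemma abs_ramanujan_weight_sum_le:
  assumes "finite T" "\<And>p. p \<in> T \<Longrightarrow> prime p \<and> p dvd N" "T \<noteq> {}"
  shows "\<bar>\<Sum>a<N. f a * (\<Prod>p\<in>T. ramanujan_weight p a)\<bar> \<le> R"
proof -
  let ?c = "\<lambda>a. \<Prod>p\<in>T. real p * of_bool (p dvd a) - 1"
  let ?d = "\<Prod>p\<in>T. real p - 1"
  have d: "?d > 0"
  proof (rule prod_pos)
    fix p assume "p \<in> T"
    then show "real p - 1 > 0" using assms(2) prime_gt_1_nat[of p] by auto
  qed
  have "norm (\<Sum>a<N. of_real (f a * ?c a) * (1::complex) ^ a) \<le> ?d * R"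
    using assms not_prime_unit by (intro norm_twisted_ramanujan_sum_le[where m = 1]) auto
  then have "norm (complex_of_real (\<Sum>a<N. f a * ?c a)) \<le> ?d * R" by simp
  then have "\<bar>\<Sum>a<N. f a * ?c a\<bar> \<le> ?d * R" by (simp only: norm_of_real)
  moreover have "(\<Sum>a<N. f a * (\<Prod>p\<in>T. ramanujan_weight p a))
      = (-1) ^ card T * (\<Sum>a<N. f a * ?c a) / ?d"
    unfolding ramanujan_weight_def
    by (simp add: prod_dividef prod_uminus sum_distrib_left sum_divide_distrib mult_ac
          del: minus_diff_eq)
  ultimately show ?thesis
    using d by (simp add: abs_mult power_abs pos_divide_le_eq mult.commute)
qed

text \<open>Each indicator is \<open>(1 - 1 / p) * (1 + ramanujan_weight p a)\<close>; multiplying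
  out gives one term for each subset of \<open>S\<close>. The empty subset carries the main term,
  the others are controlled by \<open>abs_ramanujan_weight_sum_le\<close>.\<close>

lemma sifted_sum_expansion:
  assumes "finite S" "\<And>p. p \<in> S \<Longrightarrow> prime p"
  shows "sifted_sum f N S
    = euler_ratio S * (\<Sum>T\<in>Pow S. \<Sum>a<N. f a * (\<Prod>p\<in>T. ramanujan_weight p a))"
proof -
  have "of_bool (\<forall>p\<in>S. \<not> p dvd a)
      = euler_ratio S * (\<Sum>T\<in>Pow S. \<Prod>p\<in>T. ramanujan_weight p a)" for a
  proof -
    have "(of_bool (\<forall>p\<in>S. \<not> p dvd a) :: real) = (\<Prod>p\<in>S. of_bool (\<not> p dvd a))"
      using assms(1) by (induction S) auto
    also have "\<dots> = (\<Prod>p\<in>S. (1 - 1 / real p) * (ramanujan_weight p a + 1))"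
    proof (rule prod.cong[OF refl])
      fix p assume "p \<in> S"
      then have "real p > 1" using assms(2) prime_gt_1_nat by force
      then show "of_bool (\<not> p dvd a) = (1 - 1 / real p) * (ramanujan_weight p a + 1)"
        by (simp add: ramanujan_weight_def field_simps)
    qed
    also have "\<dots> = euler_ratio S * (\<Sum>T\<in>Pow S. \<Prod>p\<in>T. ramanujan_weight p a)"
      by (simp add: prod.distrib euler_ratio_def prod_add assms(1))
    finally show ?thesis .
  qed
  then show ?thesis
    unfolding sifted_sum_def
    by (subst sum.swap) (simp add: sum_distrib_left mult_ac)
qed

lemma sifted_sum_lower_bound:
  assumes "finite S" "\<And>p. p \<in> S \<Longrightarrow> prime p \<and> p dvd N"
  shows "sifted_sum f N S \<ge> euler_ratio S * ((\<Sum>a<N. f a) - (2 ^ card S - 1) * R)"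
proof -
  let ?B = "\<lambda>T. \<Sum>a<N. f a * (\<Prod>p\<in>T. ramanujan_weight p a)"
  have "- ((2 ^ card S - 1) * R) = - (\<Sum>T\<in>Pow S - {{}}. R)"
    using assms(1) by (simp add: card_Diff_singleton card_Pow of_nat_diff)
  also have "\<dots> \<le> (\<Sum>T\<in>Pow S - {{}}. ?B T)"
    unfolding sum_negf[symmetric]
  proof (rule sum_mono)
    fix T assume "T \<in> Pow S - {{}}"
    then have "\<bar>?B T\<bar> \<le> R"
      using assms by (intro abs_ramanujan_weight_sum_le) (auto intro: finite_subset)
    then show "- R \<le> ?B T" by linarith
  qed
  finally have "(\<Sum>a<N. f a) - (2 ^ card S - 1) * R \<le> ?B {} + (\<Sum>T\<in>Pow S - {{}}. ?B T)"
    by simp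
  also have "\<dots> = (\<Sum>T\<in>Pow S. ?B T)"
    using assms(1) by (subst sum.remove[of "Pow S" "{}"]) auto
  finally show ?thesis
    using euler_ratio_pos[of S] assms by (simp add: sifted_sum_expansion mult_left_mono)
qed

text \<open>Expanding over subsets of \<open>insert r S\<close>, those avoiding \<open>r\<close>
  reproduce the sifted sum for \<open>S\<close> without any loss. Only the \<open>2 ^ card S\<close>
  subsets containing \<open>r\<close> are estimated, each at a cost of \<open>R\<close>. This
  relative comparison is what makes the sieve better than bounding every sifted sum
  separately.\<close>

lemma sifted_sum_insert_ge:
  assumes "finite S" "\<And>p. p \<in> insert r S \<Longrightarrow> prime p \<and> p dvd N" "r \<notin> S"
  shows "sifted_sum f N (insert r S)
    \<ge> (1 - 1 / real r) * (sifted_sum f N S - euler_ratio S * (2 ^ card S * R))"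
proof -
  let ?B = "\<lambda>T. \<Sum>a<N. f a * (\<Prod>p\<in>T. ramanujan_weight p a)"
  have "- (2 ^ card S * R) = (\<Sum>T\<in>Pow S. - R)"
    using assms(1) by (simp add: card_Pow)
  also have "\<dots> \<le> (\<Sum>T\<in>Pow S. ?B (insert r T))"
  proof (rule sum_mono)
    fix T assume "T \<in> Pow S"
    then have "\<bar>?B (insert r T)\<bar> \<le> R"
      using assms by (intro abs_ramanujan_weight_sum_le) (auto intro: finite_subset)
    then show "- R \<le> ?B (insert r T)" by linarith
  qed
  finally have le: "(\<Sum>T\<in>Pow S. ?B T) - 2 ^ card S * R
      \<le> (\<Sum>T\<in>Pow S. ?B T) + (\<Sum>T\<in>Pow S. ?B (insert r T))"
    by simp
  have inj: "inj_on (insert r) (Pow S)"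
    using assms(3) by (auto simp: inj_on_def)
  have "(\<Sum>T\<in>Pow (insert r S). ?B T) = (\<Sum>T\<in>Pow S. ?B T) + (\<Sum>T\<in>insert r ` Pow S. ?B T)"
    unfolding Pow_insert using assms(1,3) by (intro sum.union_disjoint) auto
  also have "\<dots> = (\<Sum>T\<in>Pow S. ?B T) + (\<Sum>T\<in>Pow S. ?B (insert r T))"
    by (simp only: sum.reindex[OF inj] o_def)
  finally have "(\<Sum>T\<in>Pow S. ?B T) - 2 ^ card S * R \<le> (\<Sum>T\<in>Pow (insert r S). ?B T)"
    using le by (simp only:)
  then have "euler_ratio (insert r S) * ((\<Sum>T\<in>Pow S. ?B T) - 2 ^ card S * R)
      \<le> euler_ratio (insert r S) * (\<Sum>T\<in>Pow (insert r S). ?B T)"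
    using euler_ratio_pos[of "insert r S"] assms(2) by (intro mult_left_mono) auto
  also have "\<dots> = sifted_sum f N (insert r S)"
    using assms by (intro sifted_sum_expansion[symmetric]) auto
  also have "euler_ratio (insert r S) = (1 - 1 / real r) * euler_ratio S"
    using assms(1,3) by (simp add: euler_ratio_def)
  finally show ?thesis
    using assms by (simp add: sifted_sum_expansion right_diff_distrib mult.assoc)
qed

text \<open>In \<open>sifted_sum_ge\<close> the total coefficient of the sifted sum for
  \<open>S\<close> is the sum of the \<open>1 - 1 / p\<close> minus \<open>card P - 1\<close>, which
  is \<delta>. The insertions contribute error weight \<open>card P - 1 + \<delta>\<close>, and the
  lower bound for \<open>S\<close> itself another \<delta>; dividing by \<delta> gives the constant
  \<open>(card P - 1) / \<delta> + 2\<close>. The isolated \<open>+ R\<close> is left over because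
  the empty subset of \<open>S\<close> carries no error.\<close>

lemma sifted_sum_sieve_bound:
  fixes \<delta> :: real
  assumes "finite S" "finite P" "S \<inter> P = {}" "\<And>p. p \<in> S \<union> P \<Longrightarrow> prime p \<and> p dvd N"
    and nonneg: "\<And>a. f a \<ge> 0"
    and \<delta>: "\<delta> = 1 - (\<Sum>p\<in>P. 1 / real p)" "\<delta> > 0"
  shows "sifted_sum f N (S \<union> P)
    \<ge> \<delta> * euler_ratio S * ((\<Sum>a<N. f a) + R - ((real (card P) - 1) / \<delta> + 2) * 2 ^ card S * R)"
proof -
  let ?C = "sifted_sum f N S" and ?E = "euler_ratio S * (2 ^ card S * R)"
  have sum_P: "(\<Sum>p\<in>P. 1 - 1 / real p) = real (card P) - 1 + \<delta>"
    by (simp add: sum_subtractf \<delta>(1))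
  have "\<delta> * ?C - (real (card P) - 1 + \<delta>) * ?E
      = (\<Sum>p\<in>P. (1 - 1 / real p) * (?C - ?E)) - (real (card P) - 1) * ?C"
    by (simp only: sum_distrib_right[symmetric] sum_P) (simp add: algebra_simps)
  also have "\<dots> \<le> (\<Sum>p\<in>P. sifted_sum f N (insert p S)) - (real (card P) - 1) * ?C"
    using assms(1-4) by (intro diff_right_mono sum_mono sifted_sum_insert_ge) auto
  also have "\<dots> \<le> sifted_sum f N (S \<union> P)"
    using assms(2) nonneg by (rule sifted_sum_ge)
  finally have main: "\<delta> * ?C - (real (card P) - 1 + \<delta>) * ?E \<le> sifted_sum f N (S \<union> P)" .
  have "\<delta> * (euler_ratio S * ((\<Sum>a<N. f a) - (2 ^ card S - 1) * R)) \<le> \<delta> * ?C"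
    using assms(1,4) \<delta>(2) by (intro mult_left_mono sifted_sum_lower_bound) auto
  moreover have "\<delta> * euler_ratio S * ((\<Sum>a<N. f a) + R - ((real (card P) - 1) / \<delta> + 2) * 2 ^ card S * R)
      = \<delta> * (euler_ratio S * ((\<Sum>a<N. f a) - (2 ^ card S - 1) * R)) - (real (card P) - 1 + \<delta>) * ?E"
    using \<delta>(2) by (simp add: field_simps)
  ultimately show ?thesis using main by linarith
qed

end

subsection \<open>Finite fields and the trace\<close>

lemma finite_field_generator_exists:
  "\<exists>g::'a::finite_field. g \<noteq> 0 \<and> bij_betw (\<lambda>a. g ^ a) {..<CARD('a) - 1} (UNIV - {0})
    \<and> (\<forall>a. g ^ a = 1 \<longleftrightarrow> CARD('a) - 1 dvd a)"
proof -
  \<comment> \<open>The type class structure is repackaged as a ring record so that the cyclicity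
    theorem for multiplicative groups of finite fields, stated for carriers, applies.\<close>
  define S :: "'a ring" where
    "S = \<lparr>carrier = UNIV, monoid.mult = (*), one = 1, ring.zero = 0, add = (+)\<rparr>"
  have "\<exists>y. x + y = 0" for x :: 'a
    using add.right_inverse by blast
  moreover have "\<exists>y. x * y = 1" if "x \<noteq> 0" for x :: 'a
    using that right_inverse by blast
  ultimately have "field S"
    unfolding S_def by unfold_locales (auto simp: algebra_simps Units_def)
  define M where "M = CARD('a) - 1"
  have pow: "x [^]\<^bsub>S\<^esub> (i::nat) = x ^ i" for x i
    by (induction i) (simp_all add: S_def nat_pow_def mult.commute)
  have "\<exists>g\<in>carrier (mult_of S). carrier (mult_of S) = {g [^]\<^bsub>S\<^esub> i | i::nat. i \<in> UNIV}"
    by (rule field.finite_field_mult_group_has_gen[OF \<open>field S\<close>])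
      (simp add: S_def)
  then obtain g :: 'a where "UNIV - {0} = {g ^ i | i::nat. i \<in> UNIV}" and "g \<noteq> 0"
    unfolding pow by (auto simp: S_def)
  then have gen: "\<exists>i. x = g ^ i" if "x \<noteq> 0" for x
    using that by blast
  have card: "card (UNIV - {0::'a}) = M" by (simp add: card_Diff_singleton M_def)
  have "CARD('a) = Suc M" by (simp add: M_def)
  then have "g ^ M * g = g" using finite_field_pow_card[of g] by (metis power_Suc2)
  then have g1: "g ^ M = 1" using \<open>g \<noteq> 0\<close> by simp
  have "M > 0" using card \<open>g \<noteq> 0\<close> by (metis card_gt_0_iff DiffI UNIV_I emptyE finite singletonD)
  have gmod: "g ^ i = g ^ (i mod M)" for i
  proof -
    have "g ^ i = g ^ (M * (i div M) + i mod M)" by simp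
    also have "\<dots> = g ^ (i mod M)" by (simp only: power_add power_mult g1 power_one mult_1)
    finally show ?thesis .
  qed
  have img: "(\<lambda>a. g ^ a) ` {..<M} = UNIV - {0}"
  proof (intro equalityI subsetI)
    fix x assume "x \<in> UNIV - {0::'a}"
    then obtain i where "x = g ^ i" using gen by blast
    then have "x = g ^ (i mod M)" using gmod by metis
    then show "x \<in> (\<lambda>a. g ^ a) ` {..<M}" using \<open>M > 0\<close> by auto
  qed (use \<open>g \<noteq> 0\<close> in auto)
  have inj: "inj_on (\<lambda>a. g ^ a) {..<M}"
    by (rule eq_card_imp_inj_on) (simp_all add: img card)
  have "g ^ a = 1 \<longleftrightarrow> M dvd a" for a
  proof -
    have "g ^ a = 1 \<longleftrightarrow> g ^ (a mod M) = g ^ 0" by (subst gmod) simp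
    also have "\<dots> \<longleftrightarrow> a mod M = 0"
      using inj \<open>M > 0\<close> by (metis inj_on_eq_iff lessThan_iff mod_less_divisor)
    finally show ?thesis by (simp add: dvd_eq_mod_eq_0)
  qed
  with inj img \<open>g \<noteq> 0\<close> show ?thesis
    unfolding M_def[symmetric] bij_betw_def by blast
qed

context
  fixes q n :: nat
  assumes card_field: "CARD('a::finite_field) = q ^ n" and q: "primepow q" and n: "n \<ge> 2"
begin

private lemma q_gt_1: "q > 1"
  using primepow_gt_Suc_0[OF q] by simp

lemma ff_trace_add: "ff_trace q n (x + y :: 'a) = ff_trace q n x + ff_trace q n y"
proof -
  obtain p e where p: "prime p" "q = p ^ e"
    using q by (auto simp: primepow_def)
  have "CHAR('a) dvd p ^ (e * n)"
    using CHAR_dvd_CARD[where 'a = 'a] by (simp only: card_field p(2) power_mult)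
  moreover have "prime CHAR('a)"
    by (simp add: prime_CHAR_semidom)
  ultimately have "CHAR('a) = p"
    using p(1) prime_dvd_power primes_dvd_imp_eq by blast
  then have "q ^ i = CHAR('a) ^ (e * i)" for i
    by (simp only: p(2) power_mult)
  then have "(x + y) ^ (q ^ i) = x ^ (q ^ i) + y ^ (q ^ i)" for i
    by (rule freshmans_dream'[OF \<open>prime CHAR('a)\<close>])
  then show ?thesis
    by (simp add: ff_trace_def sum.distrib)
qed

lemma ff_trace_scale:
  fixes c x :: 'a
  assumes "c ^ q = c"
  shows "ff_trace q n (c * x) = c * ff_trace q n x"
proof -
  have "c ^ (q ^ i) = c" for i
    by (induction i) (simp_all add: power_mult assms)
  then show ?thesis
    by (simp add: ff_trace_def power_mult_distrib sum_distrib_left)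
qed

lemma ff_trace_0: "ff_trace q n (0::'a) = 0"
  using q_gt_1 by (simp add: ff_trace_def power_0_left)

lemma ff_trace_uminus: "ff_trace q n (- x :: 'a) = - ff_trace q n x"
  using ff_trace_add[of x "- x"] by (simp add: ff_trace_0 eq_neg_iff_add_eq_0 add.commute)

lemma ff_trace_diff: "ff_trace q n (x - y :: 'a) = ff_trace q n x - ff_trace q n y"
  using ff_trace_add[of x "- y"] by (simp add: ff_trace_uminus)

lemma ff_trace_frobenius: "ff_trace q n (x::'a) ^ q = ff_trace q n x"
  using ff_trace_in_subfield[OF card_field q] n by simp

text \<open>The trace is a nonzero polynomial function of degree at most \<open>q ^ (n - 1)\<close>,
  so it has fewer than \<open>q ^ n\<close> roots.\<close>

lemma ff_trace_nonzero_exists: "\<exists>x::'a. ff_trace q n x \<noteq> 0"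
proof (rule ccontr)
  assume "\<nexists>x::'a. ff_trace q n x \<noteq> 0"
  then have zero: "ff_trace q n x = 0" for x :: 'a by blast
  define P where "P = (\<Sum>i<n. Polynomial.monom (1::'a) (q ^ i))"
  have poly: "poly P x = ff_trace q n x" for x
    by (simp add: P_def ff_trace_def poly_sum poly_monom)
  have "Polynomial.coeff P (q ^ (n - 1)) = (\<Sum>i<n. if i = n - 1 then 1 else 0)"
    unfolding P_def coeff_sum Polynomial.coeff_monom using q_gt_1 by (intro sum.cong refl) auto
  also have "\<dots> = 1" using n by simp
  finally have "P \<noteq> 0" by auto
  then have "card {x. poly P x = 0} \<le> degree P"
    by (rule card_poly_roots_bound)
  then have "q ^ n \<le> degree P"
    by (simp add: poly zero card_field)
  moreover have "degree P \<le> q ^ (n - 1)"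
    unfolding P_def
  proof (rule degree_sum_le)
    fix i assume "i \<in> {..<n}"
    then have "q ^ i \<le> q ^ (n - 1)" using q_gt_1 by (intro power_increasing) auto
    then show "degree (Polynomial.monom (1::'a) (q ^ i)) \<le> q ^ (n - 1)"
      using degree_monom_le order_trans by blast
  qed simp
  moreover have "q ^ (n - 1) < q ^ n"
    using q_gt_1 n by (intro power_strict_increasing) auto
  ultimately show False by linarith
qed

section \<open>Counting solutions of trace equations\<close>

lemma subfield_divide_closed:
  fixes c d :: 'a
  assumes "c ^ q = c" "d ^ q = d"
  shows "(c / d) ^ q = c / d"
  using assms by (simp add: power_divide)

lemma ff_trace_mult_nonzero_exists:
  fixes z :: 'a
  assumes "z \<noteq> 0"
  shows "\<exists>a. ff_trace q n (z * a) \<noteq> 0"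
proof -
  obtain x :: 'a where "ff_trace q n x \<noteq> 0" using ff_trace_nonzero_exists by blast
  then show ?thesis using assms by (intro exI[of _ "x / z"]) simp
qed

text \<open>\<open>A\<close> is a subspace over the subfield of \<open>q\<close> elements and
  \<open>a \<mapsto> Tr (z * a)\<close> a linear functional that is nonzero on it, hence onto, with
  all fibres translates of the kernel. A general \<open>A\<close> allows a second application inside
  the hyperplane of trace zero. The size of the subfield is a hypothesis here and is supplied later
  by \<open>card_subfield\<close>.\<close>

lemma card_trace_kernel:
  fixes A :: "'a set" and z :: 'a
  assumes card_sub: "card {c::'a. c ^ q = c} = q"
    and diff: "\<And>a b. a \<in> A \<Longrightarrow> b \<in> A \<Longrightarrow> a - b \<in> A"
    and add: "\<And>a b. a \<in> A \<Longrightarrow> b \<in> A \<Longrightarrow> a + b \<in> A"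
    and scale: "\<And>c a. c ^ q = c \<Longrightarrow> a \<in> A \<Longrightarrow> c * a \<in> A"
    and ex: "\<exists>a\<in>A. ff_trace q n (z * a) \<noteq> 0"
  shows "card A = q * card {a \<in> A. ff_trace q n (z * a) = 0}"
proof -
  let ?K = "{c::'a. c ^ q = c}"
  obtain b where b: "b \<in> A" "ff_trace q n (z * b) \<noteq> 0" using ex by blast
  have fibre: "card {a \<in> A. ff_trace q n (z * a) = c} = card {a \<in> A. ff_trace q n (z * a) = 0}"
    if c: "c \<in> ?K" for c
  proof -
    define t where "t = c / ff_trace q n (z * b)"
    have "t ^ q = t"
      unfolding t_def using subfield_divide_closed[of c] c ff_trace_frobenius by blast
    then have tA: "t * b \<in> A" using scale b(1) by blast
    have "ff_trace q n (z * (t * b)) = t * ff_trace q n (z * b)"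
      using ff_trace_scale[OF \<open>t ^ q = t\<close>, of "z * b"] by (simp add: mult_ac)
    then have tr: "ff_trace q n (z * (t * b)) = c" using b(2) by (simp add: t_def)
    have "bij_betw (\<lambda>a. a + t * b) {a \<in> A. ff_trace q n (z * a) = 0} {a \<in> A. ff_trace q n (z * a) = c}"
      by (rule bij_betwI[where g = "\<lambda>a. a - t * b"])
        (auto simp: add diff tA tr ff_trace_add ff_trace_diff distrib_left right_diff_distrib)
    then show ?thesis by (rule bij_betw_same_card[symmetric])
  qed
  have "card A = (\<Sum>a\<in>A. 1)" by simp
  also have "\<dots> = (\<Sum>c\<in>?K. \<Sum>a | a \<in> A \<and> ff_trace q n (z * a) = c. 1)"
    by (rule sum.group[symmetric]) (auto simp: ff_trace_frobenius)
  also have "\<dots> = (\<Sum>c\<in>?K. card {a \<in> A. ff_trace q n (z * a) = 0})"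
    by (intro sum.cong refl) (simp add: fibre)
  finally show ?thesis by (simp add: card_sub)
qed

lemma card_trace_zero:
  assumes "card {c::'a. c ^ q = c} = q"
  shows "card {x::'a. ff_trace q n x = 0} = q ^ (n - 1)"
proof -
  have "card (UNIV::'a set) = q * card {x \<in> UNIV. ff_trace q n (1 * x :: 'a) = 0}"
    using ff_trace_nonzero_exists by (intro card_trace_kernel assms) auto
  moreover have "q ^ n = q * q ^ (n - 1)" using n by (cases n) auto
  ultimately show ?thesis using card_field q_gt_1 by simp
qed

text \<open>The functionals \<open>Tr x\<close> and \<open>Tr (z * x)\<close> are linearly
  independent when \<open>z\<close> lies outside the subfield, so the second one cuts the hyperplane
  of trace zero down by another factor \<open>q\<close>.\<close>

lemma card_trace_zero_pair:
  fixes z :: 'a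
  assumes K: "card {c::'a. c ^ q = c} = q" and z: "z ^ q \<noteq> z"
  shows "card {x::'a. ff_trace q n x = 0 \<and> ff_trace q n (z * x) = 0} = q ^ (n - 2)"
proof -
  let ?A = "{x::'a. ff_trace q n x = 0}"
  have "\<exists>a\<in>?A. ff_trace q n (z * a) \<noteq> 0"
  proof (rule ccontr)
    assume "\<not> (\<exists>a\<in>?A. ff_trace q n (z * a) \<noteq> 0)"
    then have *: "ff_trace q n (z * a) = 0" if "ff_trace q n a = 0" for a using that by blast
    obtain x :: 'a where x: "ff_trace q n x \<noteq> 0" using ff_trace_nonzero_exists by blast
    \<comment> \<open>A functional vanishing on the kernel of the trace is a multiple of the trace,
      and \<open>t\<close> is the factor. Then \<open>Tr ((z - t) * a)\<close> vanishes for all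
      \<open>a\<close>, and nondegeneracy forces \<open>z = t\<close>, an element of the
      subfield.\<close>
    define t where "t = ff_trace q n (z * x) / ff_trace q n x"
    have t: "t ^ q = t"
      unfolding t_def by (intro subfield_divide_closed ff_trace_frobenius)
    have "ff_trace q n ((z - t) * a) = 0" for a
    proof -
      define u where "u = ff_trace q n a / ff_trace q n x"
      have u: "u ^ q = u"
        unfolding u_def by (intro subfield_divide_closed ff_trace_frobenius)
      have "ff_trace q n (a - u * x) = 0"
        using x by (simp only: ff_trace_diff ff_trace_scale[OF u]) (simp add: u_def)
      then have "ff_trace q n (z * (a - u * x)) = 0" by (rule *)
      then have "ff_trace q n (z * a) = u * ff_trace q n (z * x)"
        using ff_trace_scale[OF u, of "z * x"] by (simp add: right_diff_distrib ff_trace_diff mult_ac)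
      then show ?thesis
        using x by (simp only: left_diff_distrib ff_trace_diff ff_trace_scale[OF t]) (simp add: t_def u_def)
    qed
    then have "z - t = 0" using ff_trace_mult_nonzero_exists by blast
    then show False using z t by simp
  qed
  then have "card ?A = q * card {a \<in> ?A. ff_trace q n (z * a) = 0}"
    by (intro card_trace_kernel K) (auto simp: ff_trace_add ff_trace_diff ff_trace_scale)
  moreover have "q ^ (n - 1) = q * q ^ (n - 2)"
    using n by (metis One_nat_def Suc_1 Suc_diff_Suc Suc_le_lessD power_Suc)
  ultimately show ?thesis using card_trace_zero[OF K] q_gt_1 by simp
qed

end

subsection \<open>The Singer difference set\<close>

text \<open>Freeness is read off from the discrete logarithm: a prime \<open>p\<close> dividing
  \<open>m\<close> divides the group order \<open>M\<close>, so whether \<open>p\<close> divides an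
  exponent depends only on that exponent modulo \<open>M\<close>, and \<open>g ^ a\<close> is a
  \<open>p\<close>-th power iff \<open>p\<close> divides \<open>a\<close>.\<close>

lemma m_free_power_iff:
  fixes g :: "'a::finite_field"
  assumes "g \<noteq> 0" and ord: "\<And>a. g ^ a = 1 \<longleftrightarrow> M dvd a"
    and bij: "bij_betw (\<lambda>a. g ^ a) {..<M} (UNIV - {0})" and "m dvd M" "m > 0"
  shows "m_free m (g ^ a) \<longleftrightarrow> (\<forall>p\<in>prime_factors m. \<not> p dvd a)"
proof
  assume free: "m_free m (g ^ a)"
  show "\<forall>p\<in>prime_factors m. \<not> p dvd a"
  proof (intro ballI notI)
    fix p assume p: "p \<in> prime_factors m" "p dvd a"
    then obtain b where "a = b * p" by (metis dvdE mult.commute)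
    then have "g ^ a = (g ^ b) ^ p" by (simp only: power_mult)
    moreover have "p dvd m" "g ^ b \<noteq> 0" using p \<open>g \<noteq> 0\<close> by auto
    ultimately have "p = 1" using free unfolding m_free_def by blast
    then show False using p(1) in_prime_factors_imp_prime not_prime_1 by blast
  qed
next
  assume R: "\<forall>p\<in>prime_factors m. \<not> p dvd a"
  show "m_free m (g ^ a)"
    unfolding m_free_def
  proof (intro conjI allI impI)
    show "g ^ a \<noteq> 0" using \<open>g \<noteq> 0\<close> by simp
    fix d \<zeta> assume *: "d dvd m \<and> \<zeta> \<noteq> 0 \<and> g ^ a = \<zeta> ^ d"
    then obtain b where "\<zeta> = g ^ b" using bij by (auto simp: bij_betw_def)
    then have eq: "g ^ a = g ^ (b * d)" using * by (simp only: power_mult)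
    show "d = 1"
    proof (rule ccontr)
      assume "d \<noteq> 1"
      then obtain p where p: "prime p" "p dvd d" using prime_factor_nat by blast
      then have "p dvd m" using * by (meson dvd_trans)
      then have pm: "p \<in> prime_factors m" using p(1) \<open>m > 0\<close> by (simp add: in_prime_factors_iff)
      have "p dvd M" using \<open>p dvd m\<close> \<open>m dvd M\<close> by (rule dvd_trans)
      \<comment> \<open>A large multiple of the order is added to the exponent so that the
        subtraction of \<open>a\<close> below is not truncated.\<close>
      obtain N where N: "a \<le> b * d + M * N"
      proof
        have "(1::'a) \<in> (\<lambda>a. g ^ a) ` {..<M}" using bij by (simp add: bij_betw_def)
        then have "M > 0" by auto
        then show "a \<le> b * d + M * a" by (simp add: trans_le_add2)
      qed
      have "g ^ (M * N) = 1" using ord by simp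
      then have "g ^ (b * d + M * N) = g ^ a" using eq by (simp add: power_add)
      then have "g ^ a * g ^ (b * d + M * N - a) = g ^ a * 1"
        using N by (simp flip: power_add)
      then have "g ^ (b * d + M * N - a) = 1" using \<open>g \<noteq> 0\<close> by simp
      then have "M dvd b * d + M * N - a" by (simp only: ord)
      then have "p dvd b * d + M * N - a" using \<open>p dvd M\<close> by (rule dvd_trans[rotated])
      moreover have "p dvd b * d + M * N" using p(2) \<open>p dvd M\<close> by simp
      ultimately have "p dvd a" using N by (metis dvd_diffD1)
      then show False using R pm by blast
    qed
  qed
qed

text \<open>\<open>Q\<close> is the sum of the \<open>n\<close> odd numbers \<open>q ^ i\<close>
  with \<open>i < n\<close>, and \<open>n\<close> is odd. This is what makes doubling invertible
  modulo \<open>Q\<close>.\<close>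

lemma quotient_odd:
  fixes q n Q :: nat
  assumes "odd q" "odd n" "q > 1" and Q: "Q * (q - 1) = q ^ n - 1"
  shows "odd Q"
proof -
  have "int Q * (int q - 1) = int q ^ n - 1"
    using Q \<open>q > 1\<close> by (metis int_ops(2) nat_less_le of_nat_diff of_nat_mult of_nat_power one_le_power)
  also have "\<dots> = (int q - 1) * (\<Sum>i<n. int q ^ i)"
    by (rule power_diff_1_eq)
  finally have "int Q = (\<Sum>i<n. int q ^ i)" using \<open>q > 1\<close> by simp
  moreover have "odd (\<Sum>i<n. int q ^ i) = odd n"
    using \<open>odd q\<close> by (simp add: even_sum_iff)
  ultimately show ?thesis using \<open>odd n\<close> by (metis even_of_nat)
qed

section \<open>Exponents modulo \<open>Q\<close> as points of a projective space\<close>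

context
  fixes q n Q :: nat and g :: "'a::finite_field"
  assumes card_field: "CARD('a) = q ^ n" and q: "primepow q" and n: "n \<ge> 2"
    and g0: "g \<noteq> 0" and ord: "\<And>a. g ^ a = 1 \<longleftrightarrow> q ^ n - 1 dvd a"
    and bij: "bij_betw (\<lambda>a. g ^ a) {..<q ^ n - 1} (UNIV - {0})"
    and QM: "Q * (q - 1) = q ^ n - 1" and oddQ: "odd Q"
begin

private lemma q1: "q > 1"
  using primepow_gt_Suc_0[OF q] by simp

text \<open>The nonzero elements of the subfield are the powers of \<open>g ^ Q\<close>. Hence
  exponents congruent modulo \<open>Q\<close> are exactly those of elements that differ by a factor
  from the subfield.\<close>

lemma power_gen_in_subfield_iff: "(g ^ a) ^ q = g ^ a \<longleftrightarrow> Q dvd a"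
proof -
  have "(g ^ a) ^ q = g ^ a * g ^ (a * (q - 1))"
    using q1 by (metis Suc_diff_1 add_mult_distrib2 less_trans mult_1_right plus_1_eq_Suc power_add power_mult zero_less_one)
  then have "(g ^ a) ^ q = g ^ a \<longleftrightarrow> Q * (q - 1) dvd a * (q - 1)"
    using g0 ord[of "a * (q - 1)"] by (simp only: QM) simp
  then show ?thesis using q1 by simp
qed

text \<open>Each residue class modulo \<open>Q\<close> accounts for one coset of the nonzero
  subfield elements, that is, for \<open>q - 1\<close> field elements.\<close>

lemma sum_nonzero_eq_sum_power:
  fixes h :: "'a \<Rightarrow> real"
  assumes "\<And>a. h (g ^ (a + Q)) = h (g ^ a)"
  shows "(\<Sum>x\<in>UNIV - {0}. h x) = real (q - 1) * (\<Sum>a<Q. h (g ^ a))"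
proof -
  have "(\<Sum>x\<in>UNIV - {0}. h x) = (\<Sum>a<Q * (q - 1). h (g ^ a))"
    unfolding QM by (rule sum.reindex_bij_betw[OF bij, symmetric])
  also have "\<dots> = real (q - 1) * (\<Sum>a<Q. h (g ^ a))"
    using assms by (rule sum_periodic_multiple)
  finally show ?thesis .
qed

lemma card_subfield: "card {c::'a. c ^ q = c} = q"
proof -
  have Q0: "Q > 0" using oddQ by (rule odd_pos)
  have "real (card ({c::'a. c ^ q = c} - {0})) = (\<Sum>x\<in>UNIV - {0::'a}. of_bool (x ^ q = x))"
    by (simp add: set_diff_eq Int_def conj_commute)
  also have "\<dots> = real (q - 1) * (\<Sum>a<Q. of_bool ((g ^ a) ^ q = g ^ a))"
    by (rule sum_nonzero_eq_sum_power) (simp only: power_gen_in_subfield_iff dvd_add_left_iff dvd_refl)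
  also have "(\<Sum>a<Q. of_bool ((g ^ a) ^ q = g ^ a)) = (\<Sum>a<Q. of_bool (a = 0) :: real)"
    unfolding power_gen_in_subfield_iff by (intro sum.cong refl) (auto dest: dvd_imp_le)
  also have "\<dots> = 1" using Q0 by simp
  finally have "card ({c::'a. c ^ q = c} - {0}) = q - 1" by simp
  moreover have "(0::'a) \<in> {c. c ^ q = c}" using q1 by simp
  ultimately show ?thesis using q1 by (simp add: card_Diff_singleton)
qed

text \<open>With the residues modulo \<open>Q\<close> as the points of the projective space of
  dimension \<open>n - 1\<close> over the subfield, this is the indicator of a hyperplane.\<close>

definition singer :: "nat \<Rightarrow> real" where
  "singer a = of_bool (ff_trace q n (g ^ a) = 0)"

lemma singer_periodic: "singer (a + Q) = singer a"
proof -
  have "(g ^ Q) ^ q = g ^ Q" by (simp add: power_gen_in_subfield_iff)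
  then have "ff_trace q n (g ^ Q * g ^ a) = g ^ Q * ff_trace q n (g ^ a)"
    by (rule ff_trace_scale[OF card_field q n])
  then show ?thesis using g0 by (simp add: singer_def power_add mult.commute)
qed

lemma singer_square: "singer a * singer a = singer a"
  by (simp add: singer_def)

lemma sum_singer: "real (q - 1) * (\<Sum>a<Q. singer a) = real q ^ (n - 1) - 1"
proof -
  have "real (q - 1) * (\<Sum>a<Q. singer a) = (\<Sum>x\<in>UNIV - {0::'a}. of_bool (ff_trace q n x = 0))"
    using singer_periodic unfolding singer_def by (intro sum_nonzero_eq_sum_power[symmetric])
  also have "\<dots> = real (card ({x::'a. ff_trace q n x = 0} - {0}))"
    by (simp add: set_diff_eq Int_def conj_commute)
  also have "\<dots> = real q ^ (n - 1) - 1"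
    using card_trace_zero[OF card_field q n card_subfield] ff_trace_0[OF card_field q n] q1
    by (simp add: card_Diff_singleton of_nat_diff)
  finally show ?thesis .
qed

text \<open>Shifting the exponent by \<open>b\<close> moves the hyperplane to a different one,
  because \<open>g ^ b\<close> is not in the subfield. Any two distinct hyperplanes meet in equally
  many points, so the value does not depend on \<open>b\<close>.\<close>

lemma singer_autocorrelation:
  assumes "\<not> Q dvd b"
  shows "real (q - 1) * (\<Sum>a<Q. singer a * singer (a + b)) = real q ^ (n - 2) - 1"
proof -
  let ?h = "\<lambda>x::'a. of_bool (ff_trace q n x = 0) * of_bool (ff_trace q n (g ^ b * x) = 0) :: real"
  have h: "?h (g ^ a) = singer a * singer (a + b)" for a
    by (simp add: singer_def power_add mult.commute)
  have "real (q - 1) * (\<Sum>a<Q. singer a * singer (a + b)) = (\<Sum>x\<in>UNIV - {0::'a}. ?h x)"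
  proof (subst sum_nonzero_eq_sum_power)
    show "?h (g ^ (a + Q)) = ?h (g ^ a)" for a
      unfolding h using singer_periodic[of a] singer_periodic[of "a + b"] by (simp add: add_ac)
  qed (simp only: h)
  also have "\<dots> = real (card ({x::'a. ff_trace q n x = 0 \<and> ff_trace q n (g ^ b * x) = 0} - {0}))"
    by (simp add: set_diff_eq Int_def conj_ac flip: of_bool_conj)
  also have "\<dots> = real q ^ (n - 2) - 1"
    using card_trace_zero_pair[OF card_field q n card_subfield, of "g ^ b"] assms
      ff_trace_0[OF card_field q n] q1
    by (simp add: power_gen_in_subfield_iff card_Diff_singleton of_nat_diff)
  finally show ?thesis .
qed

text \<open>Since doubling permutes the residues modulo the odd number \<open>Q\<close>, the
  autocorrelation of \<open>a \<mapsto> singer (2 * a)\<close> at \<open>b\<close> is that of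
  \<open>singer\<close> at \<open>2 * b\<close>. Thus \<kappa> is the size of a hyperplane and \<mu>
  that of the intersection of two, and their difference is \<open>q ^ (n - 2)\<close>.\<close>

lemma norm_singer_double_exp_sum:
  fixes w :: complex
  assumes "w ^ Q = 1" "w \<noteq> 1"
  shows "norm (\<Sum>a<Q. of_real (singer (2 * a)) * w ^ a) \<le> sqrt (real q ^ (n - 2))"
proof -
  define \<kappa> where "\<kappa> = (\<Sum>a<Q. singer a)"
  define \<mu> where "\<mu> = (real q ^ (n - 2) - 1) / real (q - 1)"
  have "(norm (\<Sum>a<Q. of_real (singer (2 * a)) * w ^ a))\<^sup>2 = \<kappa> - \<mu>"
  proof (rule norm_exp_sum_of_autocorrelation[OF odd_pos[OF oddQ] _ assms])
    show "singer (2 * (a + Q)) = singer (2 * a)" for a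
      using singer_periodic[of "2 * a"] singer_periodic[of "2 * a + Q"] by (simp add: algebra_simps)
    show "(\<Sum>a<Q. singer (2 * a) * singer (2 * a)) = \<kappa>"
      unfolding singer_square \<kappa>_def by (rule sum_periodic_double[OF oddQ]) (rule singer_periodic)
    fix b assume b: "0 < b" "b < Q"
    have "\<not> Q dvd 2 * b"
      using b oddQ by (metis coprime_dvd_mult_right_iff coprime_right_2_iff_odd nat_dvd_not_less)
    have "(\<Sum>a<Q. singer (2 * a) * singer (2 * (a + b))) = (\<Sum>a<Q. singer a * singer (a + 2 * b))"
      unfolding distrib_left
    proof (rule sum_periodic_double[OF oddQ])
      show "singer (a + Q) * singer (a + Q + 2 * b) = singer a * singer (a + 2 * b)" for a
        using singer_periodic[of a] singer_periodic[of "a + 2 * b"] by (simp add: add_ac)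
    qed
    also have "\<dots> = \<mu>"
      using singer_autocorrelation[OF \<open>\<not> Q dvd 2 * b\<close>] q1 by (simp add: \<mu>_def field_simps)
    finally show "(\<Sum>a<Q. singer (2 * a) * singer (2 * (a + b))) = \<mu>" .
  qed
  also have "\<kappa> - \<mu> = real q ^ (n - 2)"
  proof -
    have "real q ^ (n - 1) = real q * real q ^ (n - 2)"
      using n by (metis One_nat_def Suc_1 Suc_diff_Suc Suc_le_lessD power_Suc)
    moreover have "real (q - 1) * \<mu> = real q ^ (n - 2) - 1" using q1 by (simp add: \<mu>_def)
    ultimately have "real (q - 1) * (\<kappa> - \<mu>) = real (q - 1) * real q ^ (n - 2)"
      using sum_singer q1 unfolding \<kappa>_def[symmetric] right_diff_distrib
      by (simp add: of_nat_diff left_diff_distrib)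
    then show ?thesis using q1 by simp
  qed
  finally show ?thesis by (simp add: real_le_rsqrt)
qed

text \<open>Every prime factor of \<open>m\<close> divides \<open>Q\<close>, so both freeness and
  the trace condition depend only on the exponent modulo \<open>Q\<close>.\<close>

lemma N0_eq_sifted_sum:
  assumes "m dvd Q"
  shows "real (N0 TYPE('a) q n m)
    = real (q - 1) * sifted_sum (\<lambda>a. singer (2 * a)) Q (prime_factors m)"
proof -
  have m0: "m > 0" using assms oddQ by (metis dvd_0_left_iff even_zero gr0I)
  have mM: "m dvd q ^ n - 1" using assms QM by (metis dvd_mult2)
  let ?h = "\<lambda>x::'a. of_bool (m_free m x \<and> ff_trace q n (x\<^sup>2) = 0) :: real"
  have h: "?h (g ^ a) = singer (2 * a) * of_bool (\<forall>p\<in>prime_factors m. \<not> p dvd a)" for a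
    unfolding m_free_power_iff[OF g0 ord bij mM m0] singer_def
    by (simp add: mult.commute flip: power_mult)
  have "N0 TYPE('a) q n m = card {x \<in> UNIV - {0::'a}. m_free m x \<and> ff_trace q n (x\<^sup>2) = 0}"
    unfolding N0_def by (rule arg_cong[of _ _ card]) (auto simp: m_free_def)
  then have "real (N0 TYPE('a) q n m) = (\<Sum>x\<in>UNIV - {0::'a}. ?h x)"
    by (simp add: Int_def)
  also have "\<dots> = real (q - 1) * (\<Sum>a<Q. ?h (g ^ a))"
  proof (rule sum_nonzero_eq_sum_power)
    fix a
    have "p dvd a + Q \<longleftrightarrow> p dvd a" if "p \<in> prime_factors m" for p
      using that assms by (intro dvd_add_left_iff) (auto intro: dvd_trans)
    moreover have "singer (2 * (a + Q)) = singer (2 * a)"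
      using singer_periodic[of "2 * a"] singer_periodic[of "2 * a + Q"] by (simp add: algebra_simps)
    ultimately show "?h (g ^ (a + Q)) = ?h (g ^ a)" unfolding h by simp
  qed
  finally show ?thesis unfolding h sifted_sum_def .
qed

text \<open>Multiplying a \<open>Q\<close>-free solution \<open>g ^ a\<close> by
  \<open>g ^ (Q * j)\<close>, an element of the subfield, only scales the trace of its square. It
  remains to choose \<open>j\<close> so that \<open>a + Q * j\<close> avoids every prime factor of
  \<open>q ^ n - 1\<close>.\<close>

lemma N0_full_pos:
  assumes "N0 TYPE('a) q n Q > 0"
  shows "N0 TYPE('a) q n (q ^ n - 1) > 0"
proof -
  let ?M = "q ^ n - 1"
  have M0: "?M > 0" using one_less_power[OF q1, of n] n by simp
  have Q0: "Q > 0" using oddQ by (rule odd_pos)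
  have QdM: "Q dvd ?M" using QM by (metis dvd_triv_left)
  obtain x :: 'a where x: "m_free Q x" "ff_trace q n (x\<^sup>2) = 0"
    using assms unfolding N0_def card_gt_0_iff by blast
  then have "x \<in> (\<lambda>a. g ^ a) ` {..<?M}" using bij by (simp add: bij_betw_def m_free_def)
  then obtain a where a: "x = g ^ a" by blast
  have aQ: "\<not> p dvd a" if "p \<in> prime_factors Q" for p
    using x(1) that unfolding a m_free_power_iff[OF g0 ord bij QdM Q0] by blast
  \<comment> \<open>With this \<open>j\<close>, each prime factor of \<open>q ^ n - 1\<close>
    divides exactly one of the summands \<open>a\<close> and \<open>Q * j\<close>: those dividing
    \<open>Q\<close> do not divide \<open>a\<close> by freeness, those dividing \<open>a\<close> are
    left out of \<open>j\<close>, and the remaining ones are put into \<open>j\<close>.\<close>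
  define j where "j = \<Prod>{p \<in> prime_factors ?M. \<not> p dvd Q \<and> \<not> p dvd a}"
  have "\<not> p dvd a + Q * j" if p: "p \<in> prime_factors ?M" for p
  proof -
    have pp: "prime p" using p by auto
    consider "p dvd Q" | "\<not> p dvd Q" "p dvd a" | "\<not> p dvd Q" "\<not> p dvd a" by blast
    then show ?thesis
    proof cases
      case 1
      then have "p \<in> prime_factors Q" using pp Q0 by (simp add: in_prime_factors_iff)
      then show ?thesis using aQ 1 by (simp add: dvd_add_left_iff)
    next
      case 2
      have "\<not> p dvd j"
      proof
        assume "p dvd j"
        then obtain r where r: "r \<in> prime_factors ?M" "\<not> r dvd a" "p dvd r"
          unfolding j_def using pp by (auto simp: prime_dvd_prod_iff)
        then have "p = r" using pp by (auto intro: primes_dvd_imp_eq)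
        then show False using r 2 by simp
      qed
      then show ?thesis using 2 pp by (simp add: dvd_add_right_iff prime_dvd_mult_iff)
    next
      case 3
      then have "p dvd j" unfolding j_def using p by (intro dvd_prodI) auto
      then show ?thesis using 3 by (simp add: dvd_add_left_iff)
    qed
  qed
  then have free: "m_free ?M (g ^ (a + Q * j))"
    using m_free_power_iff[OF g0 ord bij dvd_refl M0] by blast
  have "(g ^ (2 * (Q * j))) ^ q = g ^ (2 * (Q * j))" by (simp add: power_gen_in_subfield_iff)
  then have "ff_trace q n (g ^ (2 * (Q * j)) * x\<^sup>2) = 0"
    by (simp add: ff_trace_scale[OF card_field q n] x(2))
  moreover have "(g ^ (a + Q * j))\<^sup>2 = g ^ (2 * (Q * j)) * x\<^sup>2"
    by (simp only: a power_add power_mult_distrib power_mult[symmetric] mult.commute)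
  ultimately show ?thesis
    unfolding N0_def using free by (auto simp: card_gt_0_iff)
qed

end

section \<open>The sieve applied to the Singer difference set\<close>

theorem theorem6p3:
  fixes q n k s Q :: nat and p :: "nat \<Rightarrow> nat" and \<delta> :: real
  assumes card_field: "CARD('a::finite_field) = q ^ n"
    and q: "primepow q" "odd q"
    and n: "prime n" "odd n"
    and half_even: "even ((q ^ n - 1) div 2)"
    and Q: "Q = (q ^ n - 1) div (q - 1)"
    and rad_Q: "\<Prod>(prime_factors Q) = k * (\<Prod>i=1..s. p i)"
    and p_prime: "\<forall>i\<in>{1..s}. prime (p i)"
    and p_distinct: "inj_on p {1..s}"
    and p_k: "\<forall>i\<in>{1..s}. \<not> p i dvd k"
    and \<delta>: "\<delta> = 1 - (\<Sum>i=1..s. 1 / real (p i))"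
    and \<delta>_pos: "\<delta> > 0"
  shows "real (N0 TYPE('a) q n Q) >
           \<delta> * \<theta> k * real q powr (real n / 2) *
             (real q powr (real n / 2 - 1) - 2 * ((real s - 1) / \<delta> + 2) * real (W k))
       \<and> (real q powr (real n / 2 - 1) > 2 * ((real s - 1) / \<delta> + 2) * real (W k)
            \<longrightarrow> N0 TYPE('a) q n (q ^ n - 1) > 0)"
proof -
  have q1: "q > 1" using q(1) primepow_gt_Suc_0 by auto
  have n2: "n \<ge> 2" using n(1) by (rule prime_ge_2_nat)
  have "q - 1 dvd q ^ n - 1"
  proof -
    have "int q - 1 dvd int q ^ n - 1" by (simp add: power_diff_1_eq)
    then have "int (q - 1) dvd int (q ^ n - 1)" using q1 by (simp add: of_nat_diff)
    then show ?thesis by (simp only: int_dvd_int_iff)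
  qed
  then have QM: "Q * (q - 1) = q ^ n - 1" using Q by simp
  have oddQ: "odd Q" using quotient_odd[OF q(2) n(2) q1 QM] .
  then have Q0: "Q > 0" by (rule odd_pos)
  obtain g :: 'a where "g \<noteq> 0" "bij_betw (\<lambda>a. g ^ a) {..<q ^ n - 1} (UNIV - {0})"
      "\<And>a. g ^ a = 1 \<longleftrightarrow> q ^ n - 1 dvd a"
    using finite_field_generator_exists[where 'a = 'a] unfolding card_field by blast
  note g = card_field q(1) n2 this(1,3,2) QM oddQ
  define f where "f = (\<lambda>a. singer q n g (2 * a))"
  define S where "S = prime_factors k"
  define P where "P = p ` {1..s}"
  define R where "R = sqrt (real q ^ (n - 2))"

  have k0: "k > 0"
  proof (rule ccontr)
    assume "\<not> k > 0"
    then have "\<Prod>(prime_factors Q) = 0" using rad_Q by simp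
    then show False by auto
  qed
  \<comment> \<open>The radical has the same prime divisors as \<open>Q\<close>, so its given
    factorisation splits the primes of \<open>Q\<close> into those of \<open>k\<close>, which are
    expanded in full, and the \<open>p i\<close>, which are sieved.\<close>
  have in_factors: "r \<in> prime_factors Q \<longleftrightarrow> r \<in> S \<union> P" for r
  proof (cases "prime r")
    case True
    have "r dvd \<Prod>(prime_factors Q) \<longleftrightarrow> r \<in> prime_factors Q"
      using True by (auto simp: prime_dvd_prod_iff intro: dvd_refl dest: primes_dvd_imp_eq
          in_prime_factors_imp_prime)
    moreover have "r dvd k * (\<Prod>i=1..s. p i) \<longleftrightarrow> r dvd k \<or> (\<exists>i\<in>{1..s}. r dvd p i)"
      using True by (simp add: prime_dvd_mult_iff prime_dvd_prod_iff)
    moreover have "(\<exists>i\<in>{1..s}. r dvd p i) \<longleftrightarrow> r \<in> P"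
      unfolding P_def image_iff
      using True p_prime by (intro bex_cong refl) (auto intro: primes_dvd_imp_eq)
    moreover have "r dvd k \<longleftrightarrow> r \<in> S"
      unfolding S_def using True k0 by (simp add: in_prime_factors_iff)
    ultimately show ?thesis using rad_Q by simp
  next
    case False
    then show ?thesis using p_prime by (auto simp: S_def P_def dest: in_prime_factors_imp_prime)
  qed
  then have SP: "prime_factors Q = S \<union> P" by blast
  have disj: "S \<inter> P = {}"
    using p_k by (auto simp: S_def P_def dest: in_prime_factors_imp_dvd)
  have card_P: "card P = s"
    unfolding P_def using card_image[OF p_distinct] by simp
  have \<delta>_P: "\<delta> = 1 - (\<Sum>r\<in>P. 1 / real r)"
    unfolding P_def \<delta> sum.reindex[OF p_distinct] by simp
  have \<theta>_k: "\<theta> k = euler_ratio S"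
    using k0 by (simp add: \<theta>_def euler_ratio_def S_def totient_formula2)
  have \<theta>_pos: "\<theta> k > 0"
    unfolding \<theta>_k S_def by (rule euler_ratio_pos) auto
  have W_k: "real (W k) = 2 ^ card S"
    by (simp add: W_def S_def)

  have R_pos: "R > 0" unfolding R_def using q1 by simp
  have R_ge_1: "R \<ge> 1" unfolding R_def using q1 by (simp add: one_le_power)
  have R_powr: "real q powr (real n / 2 - 1) = R"
    using q1 n2 by (simp add: R_def powr_half_sqrt[symmetric] powr_powr of_nat_diff
        field_simps flip: powr_realpow)
  have X_powr: "real q powr (real n / 2) = real q * R"
    using q1 by (simp add: powr_diff flip: R_powr)
  have "R * R = real q ^ (n - 2)" unfolding R_def by simp
  then have qR: "real q * R * R = real q ^ (n - 1)"
    using n2 by (metis One_nat_def Suc_1 Suc_diff_Suc Suc_le_lessD mult.assoc power_Suc)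
  define c where "c = ((real s - 1) / \<delta> + 2) * real (W k)"
  \<comment> \<open>For \<open>s = 0\<close> the first summand is negative, but then \<delta> is 1
    and the value is 1.\<close>
  have "(real s - 1) / \<delta> + 2 > 0"
  proof (cases "s = 0")
    case True
    then show ?thesis using \<delta> by simp
  next
    case False
    then have "(real s - 1) / \<delta> \<ge> 0" using \<delta>_pos by simp
    then show ?thesis by linarith
  qed
  then have c_pos: "c > 0" unfolding c_def W_k by simp

  have sieve: "sifted_sum f Q (S \<union> P) \<ge> \<delta> * \<theta> k * ((\<Sum>a<Q. f a) + R - c * R)"
    unfolding \<theta>_k c_def W_k card_P[symmetric]
  proof (rule sifted_sum_sieve_bound)
    show "norm (\<Sum>a<Q. of_real (f a) * w ^ a) \<le> R" if "w ^ Q = 1" "w \<noteq> 1" for w :: complex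
      unfolding f_def R_def using norm_singer_double_exp_sum[OF g that] .
    show "prime r \<and> r dvd Q" if "r \<in> S \<union> P" for r
      using that in_factors[of r] by (auto dest: in_prime_factors_imp_prime in_prime_factors_imp_dvd)
    show "f a \<ge> 0" for a by (simp add: f_def singer_def[OF g])
  qed (use disj \<delta>_P \<delta>_pos in \<open>simp_all add: S_def P_def\<close>)
  have "(\<Sum>a<Q. f a) = (\<Sum>a<Q. singer q n g a)"
    unfolding f_def by (rule sum_periodic_double[OF oddQ]) (rule singer_periodic[OF g])
  then have sum_f: "(real q - 1) * (\<Sum>a<Q. f a) = real q ^ (n - 1) - 1"
    using sum_singer[OF g] q1 by (simp add: of_nat_diff)
  \<comment> \<open>By \<open>sum_f\<close> and \<open>qR\<close>, the strict inequality below
    amounts to \<open>c * R * (q + 1) + (q - 1) * R > 1\<close>. The 1 stems from the zero element,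
    excluded from the kernel of the trace; the extra \<open>+ R\<close> in the sieve bound absorbs
    it, and the error term with \<open>c\<close> gives strictness.\<close>
  have "c * R * (2 * real q) - c * R * (real q - 1) > 0"
    unfolding right_diff_distrib[symmetric] using c_pos R_pos q1 by simp
  moreover have "(real q - 1) * R \<ge> 1 * 1"
    using q1 R_ge_1 by (intro mult_mono) auto
  ultimately have "real q * R * (R - 2 * c) < (real q - 1) * ((\<Sum>a<Q. f a) + R - c * R)"
    using sum_f qR by (simp add: algebra_simps)
  then have "\<delta> * \<theta> k * (real q * R * (R - 2 * c))
      < \<delta> * \<theta> k * ((real q - 1) * ((\<Sum>a<Q. f a) + R - c * R))"
    using \<delta>_pos \<theta>_pos by (intro mult_strict_left_mono) auto
  also have "\<dots> = (real q - 1) * (\<delta> * \<theta> k * ((\<Sum>a<Q. f a) + R - c * R))"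
    by (simp only: mult_ac)
  also have "\<dots> \<le> (real q - 1) * sifted_sum f Q (S \<union> P)"
    using q1 by (intro mult_left_mono sieve) simp
  also have "\<dots> = real (N0 TYPE('a) q n Q)"
    using N0_eq_sifted_sum[OF g dvd_refl] q1 by (simp add: f_def SP of_nat_diff)
  finally have main: "real (N0 TYPE('a) q n Q) > \<delta> * \<theta> k * real q powr (real n / 2) *
      (real q powr (real n / 2 - 1) - 2 * ((real s - 1) / \<delta> + 2) * real (W k))"
    unfolding R_powr X_powr c_def by (simp only: mult.assoc)
  moreover have "N0 TYPE('a) q n (q ^ n - 1) > 0"
    if "real q powr (real n / 2 - 1) > 2 * ((real s - 1) / \<delta> + 2) * real (W k)"
  proof (rule N0_full_pos[OF g])
    have "0 < \<delta> * \<theta> k * real q powr (real n / 2) *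
        (real q powr (real n / 2 - 1) - 2 * ((real s - 1) / \<delta> + 2) * real (W k))"
      using that \<delta>_pos \<theta>_pos q1 by (intro mult_pos_pos) auto
    with main have "real (N0 TYPE('a) q n Q) > 0" by linarith
    then show "N0 TYPE('a) q n Q > 0" by simp
  qed
  ultimately show ?thesis by blast
qed

end
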